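(* For any nonnegative integers $p,q$ and any real number $\lambda$, $$\sum_{m+n=p}\binom{n}{q}\lambda^{n-q}\,\zeta(\overline{m+1})\,\zeta(\overline{n+1}) = \sum_{m+n=p}\binom{n}{q}(\lambda+1)^{n-q}\,\zeta(m+1,\overline{n+1}) + \sum_{\substack{m+n=p\\ a+b=q}}\binom{m}{a}\binom{n}{b}\lambda^{m-a}(\lambda+1)^{n-b}\,\zeta(m+1,\overline{n+1}),$$ where $m,n,a,b$ run over nonnegative integers.
   Context: A bar over an argument indicates a sign $(-1)^{k_j}$ in the numerator of the summand at the corresponding index: for positive integers $r,s$, $\zeta(\overline{s})=\sum_{k\ge1}\frac{(-1)^k}{k^s}$ and $\zeta(r,\overline{s})=\sum_{1\le k_1<k_2}\frac{(-1)^{k_2}}{k_1^{r}k_2^{s}}$ (when $s=1$ the series are understood as conditionally convergent, i.e. as the limit of partial sums over the largest index). Terms whose binomial coefficient vanishes are taken to be $0$, and $0^0=1$. *)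

theory Defs imports Complex_Main begin

text \<open>
  Alternating zeta values at positive integers. A series over \<open>1 \<le> k\<close> or over
  \<open>1 \<le> k\<^sub>1 < k\<^sub>2\<close> is summed as the limit of its partial sums over the largest index; this is
  the convention needed when \<open>s = 1\<close>, where convergence is only conditional, and for
  \<open>s \<ge> 2\<close> the series converge absolutely, so it is the usual sum.
\<close>

definition zeta_bar :: "nat \<Rightarrow> real" where
  "zeta_bar s = lim (\<lambda>N. \<Sum>k=1..N. (-1) ^ k / real k ^ s)"

definition zeta2_bar :: "nat \<Rightarrow> nat \<Rightarrow> real" where
  "zeta2_bar r s =
     lim (\<lambda>N. \<Sum>(k1, k2) \<in> {(k1, k2). 1 \<le> k1 \<and> k1 < k2 \<and> k2 \<le> N}.
                (-1) ^ k2 / (real k1 ^ r * real k2 ^ s))"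

end

theory Submission
  imports Defs "HOL-Computational_Algebra.Polynomial"
begin

text \<open>
  The identity is a weighted form of the shuffle product
  \<open>1 / (k l) = 1 / (k (k + l)) + 1 / (l (k + l))\<close>. Its sign \<open>(-1)\<^bsup>k + l\<^esup>\<close> depends only on the
  larger summation index \<open>k + l\<close> of the right-hand side, which is why only the last argument of
  the double zeta values carries a bar.

  For \<open>q = 0\<close>, write \<open>\<mu>\<close> for \<open>\<lambda>\<close> and let \<open>h\<^sub>p\<close> be the complete homogeneous polynomial of
  degree \<open>p\<close> in two variables. The weight \<open>\<Sum>\<^bsub>m+n=p\<^esub> \<mu>\<^sup>n / (k\<^bsup>m+1\<^esup> l\<^bsup>n+1\<^esup>)\<close> is
  \<open>h\<^sub>p(1/k, \<mu>/l) / (k l)\<close>, and the point \<open>(\<mu> + 1) / (k + l)\<close> is the weighted mean of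
  \<open>1/k\<close> and \<open>\<mu>/l\<close> with weights \<open>k\<close> and \<open>l\<close>. For such a mean \<open>w\<close> of \<open>u\<close> and \<open>v\<close> one has
  \<open>(k + l) h\<^sub>p(u, v) = l h\<^sub>p(u, w) + k h\<^sub>p(v, w)\<close> (lemma \<open>complete_hom_weighted_mean\<close>), and this
  splits the weight into the two kinds of summands of the right-hand side. Summing over the
  triangle \<open>k + l \<le> N\<close> gives an exact identity between finite sums, whose right-hand side
  consists of the partial sums that define the double zeta values.

  In the limit \<open>N \<rightarrow> \<infinity>\<close> the one analytic point is that summing the product of two alternating
  series over triangles instead of squares still gives the product of the sums, although both
  series may converge only conditionally. This follows from the Leibniz bound \<open>1 / (N + 1)\<close> on
  the remainders, since the resulting error is a multiple of \<open>H\<^sub>N / (N + 1)\<close>, where \<open>H\<^sub>N\<close> is the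
  harmonic number (lemma \<open>triangle_sum_tendsto\<close>).

  The case of general \<open>q\<close> is the coefficient of \<open>y\<^sup>q\<close> in the case \<open>q = 0\<close> at \<open>\<mu> = \<lambda> + y\<close>, both
  sides of which are polynomials in \<open>y\<close>.
\<close>

section \<open>Complete homogeneous polynomials in two variables\<close>

definition complete_hom :: "nat \<Rightarrow> 'a::comm_semiring_1 \<Rightarrow> 'a \<Rightarrow> 'a" where
  "complete_hom p u v = (\<Sum>n\<le>p. u ^ (p - n) * v ^ n)"

lemma complete_hom_0 [simp]: "complete_hom 0 u v = 1"
  by (simp add: complete_hom_def)

lemma complete_hom_Suc_right:
  "complete_hom (Suc p) u v = u ^ Suc p + v * complete_hom p u v"
  unfolding complete_hom_def sum.atMost_Suc_shift
  by (simp add: sum_distrib_left mult_ac)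

lemma complete_hom_Suc_left:
  "complete_hom (Suc p) u v = v ^ Suc p + u * complete_hom p u v"
proof -
  have "(\<Sum>n\<le>p. u ^ (Suc p - n) * v ^ n) = u * (\<Sum>n\<le>p. u ^ (p - n) * v ^ n)"
    unfolding sum_distrib_left by (intro sum.cong) (auto simp: Suc_diff_le mult_ac)
  then show ?thesis
    by (simp add: complete_hom_def add.commute)
qed

text \<open>
  Over a field, for distinct \<open>u, v\<close> and nonzero \<open>k, l, k + l\<close>, this says that the divided difference
  \<open>h\<^sub>p(u, v) = (u\<^bsup>p+1\<^esup> - v\<^bsup>p+1\<^esup>) / (u - v)\<close> is split by inserting \<open>w\<^bsup>p+1\<^esup>\<close>, as \<open>u - w\<close> and \<open>w - v\<close>
  are in the ratio \<open>l : k\<close>. The induction avoids division: the recurrence on the right produces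
  \<open>w\<close> next to the factor \<open>k + l\<close>, where it can be traded for \<open>k u + l v\<close>.
\<close>
lemma complete_hom_weighted_mean:
  fixes k l u v w :: "'a::comm_ring_1"
  assumes mean: "(k + l) * w = k * u + l * v"
  shows "(k + l) * complete_hom p u v = l * complete_hom p u w + k * complete_hom p v w"
proof (induction p)
  case 0
  show ?case by simp
next
  case (Suc p)
  have "l * complete_hom (Suc p) u w + k * complete_hom (Suc p) v w
      = l * u ^ Suc p + k * v ^ Suc p + w * (l * complete_hom p u w + k * complete_hom p v w)"
    unfolding complete_hom_Suc_right[of p _ w] by (simp add: algebra_simps)
  also have "\<dots> = l * u ^ Suc p + k * v ^ Suc p + ((k + l) * w) * complete_hom p u v"
    unfolding Suc.IH[symmetric] by (simp only: mult_ac)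
  also have "\<dots> = l * (u ^ Suc p + v * complete_hom p u v) + k * (v ^ Suc p + u * complete_hom p u v)"
    unfolding mean by (simp add: algebra_simps)
  also have "\<dots> = (k + l) * complete_hom (Suc p) u v"
    unfolding complete_hom_Suc_right[symmetric] complete_hom_Suc_left[symmetric]
    by (simp only: distrib_right add.commute)
  finally show ?case by simp
qed

lemma weighted_power_sum_eq_complete_hom:
  fixes x y a b :: real
  shows "(\<Sum>n\<le>p. a ^ (p - n) * b ^ n / (x ^ (p - n + 1) * y ^ (n + 1)))
       = complete_hom p (a / x) (b / y) / (x * y)"
  unfolding complete_hom_def sum_divide_distrib
  by (intro sum.cong) (auto simp: power_divide field_simps)

lemma shuffle_partial_fractions:
  fixes k l mu :: real
  assumes "k > 0" "l > 0"
  shows "(\<Sum>n\<le>p. mu ^ n / (k ^ (p - n + 1) * l ^ (n + 1)))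
       = (\<Sum>n\<le>p. (mu + 1) ^ n / (k ^ (p - n + 1) * (k + l) ^ (n + 1)))
       + (\<Sum>n\<le>p. mu ^ (p - n) * (mu + 1) ^ n / (l ^ (p - n + 1) * (k + l) ^ (n + 1)))"
proof -
  let ?u = "1 / k" and ?v = "mu / l" and ?w = "(mu + 1) / (k + l)"
  have "(k + l) * ?w = k * ?u + l * ?v"
    using assms by (simp add: add.commute)
  from complete_hom_weighted_mean[OF this, of p]
  have "complete_hom p ?u ?v / (k * l)
      = complete_hom p ?u ?w / (k * (k + l)) + complete_hom p ?v ?w / (l * (k + l))"
    using assms by (simp add: divide_simps) (simp add: algebra_simps)
  then show ?thesis
    using weighted_power_sum_eq_complete_hom[of 1 p mu k l]
      weighted_power_sum_eq_complete_hom[of 1 p "mu + 1" k "k + l"]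
      weighted_power_sum_eq_complete_hom[of mu p "mu + 1" l "k + l"]
    by simp
qed

section \<open>The identity between partial sums\<close>

definition zeta2_bar_sum :: "nat \<Rightarrow> nat \<Rightarrow> nat \<Rightarrow> real" where
  "zeta2_bar_sum N r s = (\<Sum>(k1, k2) \<in> {(k1, k2). 1 \<le> k1 \<and> k1 < k2 \<and> k2 \<le> N}.
                (-1) ^ k2 / (real k1 ^ r * real k2 ^ s))"

definition triangle :: "nat \<Rightarrow> (nat \<times> nat) set" where
  "triangle N = {(k, l). 1 \<le> k \<and> 1 \<le> l \<and> k + l \<le> N}"

definition triangle_sum :: "nat \<Rightarrow> nat \<Rightarrow> nat \<Rightarrow> real" where
  "triangle_sum N r s = (\<Sum>(k, l)\<in>triangle N. (-1) ^ (k + l) / (real k ^ r * real l ^ s))"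

lemma zeta2_bar_sum_eq_left:
  "zeta2_bar_sum N r s
     = (\<Sum>(k, l)\<in>triangle N. (-1) ^ (k + l) / (real k ^ r * (real k + real l) ^ s))"
  unfolding zeta2_bar_sum_def triangle_def
  by (rule sum.reindex_bij_witness[of _ "\<lambda>(k, l). (k, k + l)" "\<lambda>(k1, k2). (k1, k2 - k1)"])
     (auto simp: of_nat_diff)

lemma zeta2_bar_sum_eq_right:
  "zeta2_bar_sum N r s
     = (\<Sum>(k, l)\<in>triangle N. (-1) ^ (k + l) / (real l ^ r * (real k + real l) ^ s))"
  unfolding zeta2_bar_sum_def triangle_def
  by (rule sum.reindex_bij_witness[of _ "\<lambda>(k, l). (l, k + l)" "\<lambda>(k1, k2). (k2 - k1, k1)"])
     (auto simp: of_nat_diff)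

lemma shuffle_partial_sums:
  fixes mu :: real
  shows "(\<Sum>n\<le>p. mu ^ n * triangle_sum N (p - n + 1) (n + 1))
       = (\<Sum>n\<le>p. (mu + 1) ^ n * zeta2_bar_sum N (p - n + 1) (n + 1))
       + (\<Sum>n\<le>p. mu ^ (p - n) * (mu + 1) ^ n * zeta2_bar_sum N (p - n + 1) (n + 1))"
proof -
  have swap: "(\<Sum>n\<le>p. c n * (\<Sum>(k, l)\<in>triangle N. (-1) ^ (k + l) / d n k l))
      = (\<Sum>(k, l)\<in>triangle N. (-1) ^ (k + l) * (\<Sum>n\<le>p. c n / d n k l))"
    for c :: "nat \<Rightarrow> real" and d :: "nat \<Rightarrow> nat \<Rightarrow> nat \<Rightarrow> real"
    unfolding sum_distrib_left
    by (subst sum.swap) (auto intro!: sum.cong simp: sum_distrib_left)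
  have "(\<Sum>n\<le>p. mu ^ n * triangle_sum N (p - n + 1) (n + 1))
      = (\<Sum>(k, l)\<in>triangle N. (-1) ^ (k + l) *
          (\<Sum>n\<le>p. mu ^ n / (real k ^ (p - n + 1) * real l ^ (n + 1))))"
    unfolding triangle_sum_def by (rule swap)
  also have "\<dots> = (\<Sum>(k, l)\<in>triangle N. (-1) ^ (k + l) *
          (\<Sum>n\<le>p. (mu + 1) ^ n / (real k ^ (p - n + 1) * (real k + real l) ^ (n + 1))))
      + (\<Sum>(k, l)\<in>triangle N. (-1) ^ (k + l) *
          (\<Sum>n\<le>p. mu ^ (p - n) * (mu + 1) ^ n
                    / (real l ^ (p - n + 1) * (real k + real l) ^ (n + 1))))"
    unfolding sum.distrib[symmetric]
  proof (intro sum.cong refl, clarify)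
    fix k l assume "(k, l) \<in> triangle N"
    then have "real k > 0" "real l > 0" by (auto simp: triangle_def)
    from shuffle_partial_fractions[OF this, of mu p]
    show "(-1) ^ (k + l) * (\<Sum>n\<le>p. mu ^ n / (real k ^ (p - n + 1) * real l ^ (n + 1)))
      = (-1) ^ (k + l) *
          (\<Sum>n\<le>p. (mu + 1) ^ n / (real k ^ (p - n + 1) * (real k + real l) ^ (n + 1)))
      + (-1) ^ (k + l) *
          (\<Sum>n\<le>p. mu ^ (p - n) * (mu + 1) ^ n
                    / (real l ^ (p - n + 1) * (real k + real l) ^ (n + 1)))"
      by (simp only: distrib_left)
  qed
  also have "\<dots> = (\<Sum>n\<le>p. (mu + 1) ^ n * zeta2_bar_sum N (p - n + 1) (n + 1))
       + (\<Sum>n\<le>p. mu ^ (p - n) * (mu + 1) ^ n * zeta2_bar_sum N (p - n + 1) (n + 1))"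
    unfolding swap[symmetric] zeta2_bar_sum_eq_left[symmetric] zeta2_bar_sum_eq_right[symmetric] ..
  finally show ?thesis .
qed

section \<open>Convergence of the alternating series\<close>

lemma tendsto_0_sequence_comparison:
  fixes f g :: "nat \<Rightarrow> real"
  assumes "\<And>n. \<bar>f n\<bar> \<le> g n" "g \<longlonglongrightarrow> 0"
  shows "f \<longlonglongrightarrow> 0"
proof (rule tendsto_0_le[OF assms(2), of _ 1], rule always_eventually, rule allI)
  show "norm (f n) \<le> norm (g n) * 1" for n
    using assms(1)[of n] by simp
qed

lemma alternating_series_remainder:
  fixes a :: "nat \<Rightarrow> real"
  assumes "a \<longlonglongrightarrow> 0" "\<And>n. 0 \<le> a n" "\<And>n. a (Suc n) \<le> a n"
  shows "\<bar>(\<Sum>i<N. (-1) ^ i * a i) - (\<Sum>i. (-1) ^ i * a i)\<bar> \<le> a N"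
proof (cases "even N")
  case True
  then obtain n where "N = 2 * n" by (elim evenE)
  then show ?thesis
    using summable_Leibniz'(2)[OF assms, of n] summable_Leibniz'(4)[OF assms, of n] by simp
next
  case False
  then obtain n where "N = 2 * n + 1" by (elim oddE)
  then show ?thesis
    using summable_Leibniz'(2)[OF assms, of "Suc n"] summable_Leibniz'(4)[OF assms, of n] by simp
qed

definition zeta_bar_sum :: "nat \<Rightarrow> nat \<Rightarrow> real" where
  "zeta_bar_sum N s = (\<Sum>k=1..N. (-1) ^ k / real k ^ s)"

lemma zeta_bar_remainder:
  assumes "s \<ge> 1"
  shows "\<bar>zeta_bar_sum N s - zeta_bar s\<bar> \<le> 1 / real (Suc N)"
proof -
  define a where "a = (\<lambda>i. 1 / real (Suc i) ^ s)"
  define S where "S = (\<Sum>i. (-1) ^ i * a i)"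
  have a_le: "a i \<le> 1 / real (Suc i)" for i
    using assms self_le_power[of "real (Suc i)" s]
    by (auto simp: a_def intro!: divide_left_mono)
  have a_nonneg: "0 \<le> a i" for i
    by (simp add: a_def)
  have a_lim: "a \<longlonglongrightarrow> 0"
    by (rule tendsto_sandwich[OF _ _ tendsto_const LIMSEQ_inverse_real_of_nat])
       (use a_nonneg a_le in \<open>auto simp: divide_inverse\<close>)
  have a_mono: "a (Suc i) \<le> a i" for i
    by (auto simp: a_def intro!: divide_left_mono power_mono)
  have sum_eq: "zeta_bar_sum M s = - (\<Sum>i<M. (-1) ^ i * a i)" for M
    unfolding zeta_bar_sum_def by (induction M) (auto simp: a_def)
  have bound: "\<bar>zeta_bar_sum M s - (- S)\<bar> \<le> 1 / real (Suc M)" for M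
    using alternating_series_remainder[OF a_lim a_nonneg a_mono, of M] a_le[of M]
    unfolding sum_eq S_def by linarith
  have "(\<lambda>M. zeta_bar_sum M s - (- S)) \<longlonglongrightarrow> 0"
    by (rule tendsto_0_sequence_comparison[OF bound[unfolded divide_inverse mult_1_left]
          LIMSEQ_inverse_real_of_nat])
  then have "(\<lambda>M. zeta_bar_sum M s) \<longlonglongrightarrow> - S"
    by (rule LIM_zero_cancel)
  then have "zeta_bar s = - S"
    unfolding zeta_bar_def zeta_bar_sum_def by (rule limI)
  with bound show ?thesis by simp
qed

lemma zeta_bar_sum_tendsto:
  assumes "s \<ge> 1"
  shows "(\<lambda>N. zeta_bar_sum N s) \<longlonglongrightarrow> zeta_bar s"
  by (rule LIM_zero_cancel, rule tendsto_0_sequence_comparison[OF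
        zeta_bar_remainder[OF assms, unfolded divide_inverse mult_1_left]
        LIMSEQ_inverse_real_of_nat])

text \<open>
  Any bound that is \<open>o(N)\<close> makes the errors below vanish in the limit. The square root is chosen
  because \<open>1 / N \<le> 2 (sqrt N - sqrt (N - 1))\<close> telescopes.
\<close>
lemma harmonic_sum_le_sqrt: "(\<Sum>k=1..N. 1 / real k) \<le> 2 * sqrt (real N)"
proof (induction N)
  case (Suc N)
  let ?x = "sqrt (real N)" and ?y = "sqrt (real (Suc N))"
  have y: "?y * ?y = real (Suc N)" "?x * ?x = real N" "?x \<le> ?y" "?y > 0" by simp_all
  have "1 = (?y + ?x) * (?y - ?x)"
    using y by (simp add: algebra_simps)
  also have "\<dots> \<le> (2 * ?y) * (?y - ?x)"
    using y by (intro mult_right_mono) auto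
  also have "\<dots> \<le> (2 * real (Suc N)) * (?y - ?x)"
    using y mult_left_mono[of 1 ?y ?y] by (intro mult_right_mono) auto
  finally have "1 / real (Suc N) \<le> 2 * (?y - ?x)"
    by (simp add: field_simps)
  with Suc show ?case by simp
qed simp

lemma inverse_sqrt_tendsto_0: "(\<lambda>N. c / sqrt (real (Suc N))) \<longlonglongrightarrow> 0"
proof -
  have "filterlim (\<lambda>N. sqrt (real (Suc N))) at_top sequentially"
    by (intro filterlim_compose[OF sqrt_at_top] filterlim_compose[OF filterlim_real_sequentially]
        filterlim_Suc)
  then show ?thesis
    by (intro real_tendsto_divide_at_top[OF tendsto_const])
qed

lemma zeta2_bar_sum_Suc:
  "zeta2_bar_sum (Suc N) r s = zeta2_bar_sum N r s
     + (-1) ^ Suc N * ((\<Sum>k=1..N. 1 / real k ^ r) / real (Suc N) ^ s)"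
proof -
  let ?T = "\<lambda>M. {(k1, k2). 1 \<le> k1 \<and> k1 < k2 \<and> k2 \<le> M}"
  have fin: "finite (?T N)"
    by (rule finite_subset[of _ "{..N} \<times> {..N}"]) auto
  have split: "?T (Suc N) = ?T N \<union> (\<lambda>k. (k, Suc N)) ` {1..N}"
    by (auto simp: le_Suc_eq)
  show ?thesis
    unfolding zeta2_bar_sum_def split
    by (subst sum.union_disjoint[OF fin])
       (auto simp: sum.reindex inj_on_def sum_divide_distrib sum_negf sum_distrib_left mult_ac
             intro!: sum.cong)
qed

text \<open>
  The coefficients \<open>(\<Sum>j<k. 1 / j\<^sup>r) / k\<^sup>s\<close> of \<open>(-1)\<^sup>k\<close>, where \<open>j \<ge> 1\<close>, decrease from \<open>k = 2\<close> on:
  the numerator is at least its first term \<open>1\<close>, so passing from \<open>k\<close> to \<open>k + 1\<close> multiplies it by at most \<open>1 + 1 / k\<close>,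
  while the denominator grows by at least that factor. Hence the Leibniz criterion applies to the
  sum over the largest index. At \<open>k = 1\<close> the coefficient is \<open>0\<close>, so the alternating series
  starts at \<open>k = 2\<close>.
\<close>
lemma zeta2_bar_sum_tendsto:
  assumes "r \<ge> 1" "s \<ge> 1"
  shows "(\<lambda>N. zeta2_bar_sum N r s) \<longlonglongrightarrow> zeta2_bar r s"
proof -
  define A where "A = (\<lambda>i. \<Sum>k=1..Suc i. 1 / real k ^ r)"
  define a where "a = (\<lambda>i. A i / real (Suc (Suc i)) ^ s)"
  have A_ge: "A i \<ge> 1" for i
    unfolding A_def by (induction i) (auto intro: add_increasing2)
  have A_le: "A i \<le> 2 * sqrt (real (Suc (Suc i)))" for i
  proof -
    have "A i \<le> (\<Sum>k=1..Suc i. 1 / real k)"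
      unfolding A_def
      by (intro sum_mono divide_left_mono) (use assms in \<open>auto intro!: self_le_power\<close>)
    also have "\<dots> \<le> 2 * sqrt (real (Suc i))"
      by (rule harmonic_sum_le_sqrt)
    also have "\<dots> \<le> 2 * sqrt (real (Suc (Suc i)))"
      by simp
    finally show ?thesis .
  qed
  have a_nonneg: "0 \<le> a i" for i
    using A_ge[of i] by (simp add: a_def)
  have a_le: "a i \<le> 2 / sqrt (real (Suc (Suc i)))" for i
  proof -
    have "a i \<le> (2 * sqrt (real (Suc (Suc i)))) / real (Suc (Suc i))"
      unfolding a_def using A_le[of i] A_ge[of i] assms
      by (intro frac_le) (auto intro!: self_le_power)
    also have "\<dots> = 2 / sqrt (real (Suc (Suc i)))"
      by (metis (no_types, lifting) of_nat_0_le_iff real_div_sqrt divide_divide_eq_right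
          times_divide_eq_left divide_divide_eq_left' real_divide_square_eq mult.commute
          real_sqrt_mult_self abs_of_nat)
    finally show ?thesis .
  qed
  have a_lim: "a \<longlonglongrightarrow> 0"
    by (rule tendsto_sandwich[OF _ _ tendsto_const LIMSEQ_Suc[OF inverse_sqrt_tendsto_0[of 2]]])
       (use a_nonneg a_le in auto)
  have a_mono: "a (Suc i) \<le> a i" for i
  proof -
    define x where "x = real (Suc (Suc i))"
    have x: "x \<ge> 1" by (simp add: x_def)
    have "A (Suc i) = A i + 1 / x ^ r"
      by (simp add: A_def x_def)
    also have "\<dots> \<le> A i + A i / x"
      using A_ge[of i] x assms by (intro add_left_mono frac_le) (auto intro!: self_le_power)
    also have "\<dots> = A i * (1 + 1 / x)"
      by (simp add: field_simps)
    finally have num: "A (Suc i) \<le> A i * (1 + 1 / x)" .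
    have "x ^ s * (1 + 1 / x) \<le> x ^ s * (1 + 1 / x) ^ s"
      using x assms by (intro mult_left_mono self_le_power) auto
    also have "\<dots> = (x + 1) ^ s"
      using x by (simp add: power_mult_distrib[symmetric] field_simps)
    finally have den: "x ^ s * (1 + 1 / x) \<le> (x + 1) ^ s" .
    have pos: "1 + 1 / x > 0" using x by (simp add: add_pos_pos)
    have "a (Suc i) = A (Suc i) / (x + 1) ^ s"
      by (simp add: a_def x_def add.commute)
    also have "\<dots> \<le> (A i * (1 + 1 / x)) / (x ^ s * (1 + 1 / x))"
      using num den pos x A_ge[of i] A_ge[of "Suc i"] by (intro frac_le) auto
    also have "\<dots> = a i"
      using pos by (simp add: a_def x_def)
    finally show ?thesis .
  qed
  have sum_eq: "zeta2_bar_sum (Suc M) r s = (\<Sum>i<M. (-1) ^ i * a i)" for M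
  proof (induction M)
    case 0
    have empty: "{(k1, k2). 1 \<le> k1 \<and> k1 < k2 \<and> k2 \<le> Suc 0} = ({} :: (nat \<times> nat) set)" by auto
    show ?case unfolding zeta2_bar_sum_def empty by simp
  next
    case (Suc M)
    then show ?case
      by (subst zeta2_bar_sum_Suc) (simp add: a_def A_def)
  qed
  have "(\<lambda>M. zeta2_bar_sum (Suc M) r s) \<longlonglongrightarrow> (\<Sum>i. (-1) ^ i * a i)"
    unfolding sum_eq
    by (rule summable_LIMSEQ[OF summable_Leibniz'(1)[OF a_lim a_nonneg a_mono]])
  then have "(\<lambda>M. zeta2_bar_sum M r s) \<longlonglongrightarrow> (\<Sum>i. (-1) ^ i * a i)"
    by (rule LIMSEQ_imp_Suc)
  then show ?thesis
    unfolding zeta2_bar_def zeta2_bar_sum_def by (simp add: limI)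
qed

text \<open>
  Mertens' theorem on Cauchy products does not cover \<open>r = s = 1\<close>, where both series converge only
  conditionally. Instead, a triangle is cut into rows: row \<open>k\<close> contributes its
  coefficient times a partial sum of the second series, whose remainder is at most
  \<open>1 / (N - k + 1)\<close>. The total error is bounded by \<open>\<Sum>\<^sub>k 1 / (k (N - k + 1)) = 2 H\<^sub>N / (N + 1)\<close>.
\<close>
lemma triangle_sum_tendsto:
  assumes "r \<ge> 1" "s \<ge> 1"
  shows "(\<lambda>N. triangle_sum N r s) \<longlonglongrightarrow> zeta_bar r * zeta_bar s"
proof -
  define e where "e = (\<lambda>N. triangle_sum N r s - zeta_bar_sum N r * zeta_bar s)"
  have rows: "triangle_sum N r s
      = (\<Sum>k=1..N. (-1) ^ k / real k ^ r * zeta_bar_sum (N - k) s)" for N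
  proof -
    have "triangle N = (SIGMA k:{1..N}. {1..N - k})"
      by (auto simp: triangle_def)
    then have "triangle_sum N r s
        = (\<Sum>k=1..N. \<Sum>l=1..N - k. (-1) ^ (k + l) / (real k ^ r * real l ^ s))"
      unfolding triangle_sum_def by (simp add: sum.Sigma)
    then show ?thesis
      by (simp add: zeta_bar_sum_def sum_distrib_left power_add)
  qed
  have bound: "\<bar>e N\<bar> \<le> 4 / sqrt (real (Suc N))" for N
  proof -
    have "e N = (\<Sum>k=1..N. (-1) ^ k / real k ^ r * (zeta_bar_sum (N - k) s - zeta_bar s))"
      unfolding e_def rows zeta_bar_sum_def[of N]
      by (simp add: sum_distrib_right sum_subtractf right_diff_distrib)
    also have "\<bar>\<dots>\<bar> \<le> (\<Sum>k=1..N. 1 / real k * (1 / real (Suc (N - k))))"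
    proof (intro order.trans[OF sum_abs] sum_mono)
      fix k assume k: "k \<in> {1..N}"
      have "\<bar>(-1) ^ k / real k ^ r\<bar> \<le> 1 / real k"
        using k assms by (auto simp: abs_mult power_abs intro!: divide_left_mono self_le_power)
      then show "\<bar>(-1) ^ k / real k ^ r * (zeta_bar_sum (N - k) s - zeta_bar s)\<bar>
          \<le> 1 / real k * (1 / real (Suc (N - k)))"
        unfolding abs_mult using zeta_bar_remainder[OF assms(2)] by (intro mult_mono) auto
    qed
    also have "\<dots> = (\<Sum>k=1..N. (1 / real k + 1 / real (Suc (N - k))) / real (Suc N))"
    proof (intro sum.cong refl)
      fix k assume "k \<in> {1..N}"
      then have N: "real (Suc N) = real k + real (Suc (N - k))" and "real k > 0"
        by (auto simp: of_nat_diff)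
      have "1 / x * (1 / y) = (1 / x + 1 / y) / (x + y)" if "x > 0" "y > 0" for x y :: real
        using that by (simp add: divide_simps)
      then show "1 / real k * (1 / real (Suc (N - k)))
          = (1 / real k + 1 / real (Suc (N - k))) / real (Suc N)"
        unfolding N using \<open>real k > 0\<close> by (simp del: of_nat_Suc)
    qed
    also have "\<dots> = ((\<Sum>k=1..N. 1 / real k) + (\<Sum>k=1..N. 1 / real (Suc (N - k)))) / real (Suc N)"
      by (simp add: sum.distrib sum_divide_distrib add_divide_distrib)
    also have "(\<Sum>k=1..N. 1 / real (Suc (N - k))) = (\<Sum>k=1..N. 1 / real k)"
      by (rule sum.reindex_bij_witness[of _ "\<lambda>k. Suc N - k" "\<lambda>k. Suc N - k"])
         (auto simp: Suc_diff_le)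
    also have "((\<Sum>k=1..N. 1 / real k) + (\<Sum>k=1..N. 1 / real k)) / real (Suc N)
        \<le> (4 * sqrt (real (Suc N))) / real (Suc N)"
    proof (intro divide_right_mono)
      have "sqrt (real N) \<le> sqrt (real (Suc N))" by simp
      with harmonic_sum_le_sqrt[of N]
      show "(\<Sum>k=1..N. 1 / real k) + (\<Sum>k=1..N. 1 / real k) \<le> 4 * sqrt (real (Suc N))"
        by linarith
    qed simp
    also have "\<dots> = 4 / sqrt (real (Suc N))"
      by (simp add: field_simps)
    finally show ?thesis .
  qed
  have "e \<longlonglongrightarrow> 0"
    by (rule tendsto_0_sequence_comparison[OF bound inverse_sqrt_tendsto_0])
  from tendsto_add[OF this tendsto_mult[OF zeta_bar_sum_tendsto[OF assms(1)] tendsto_const[of "zeta_bar s"]]]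
  show ?thesis by (simp add: e_def)
qed

section \<open>The identity and its Taylor coefficients\<close>

lemma shuffle_zeta_bar:
  fixes mu :: real
  shows "(\<Sum>n\<le>p. mu ^ n * (zeta_bar (p - n + 1) * zeta_bar (n + 1)))
       = (\<Sum>n\<le>p. (mu + 1) ^ n * zeta2_bar (p - n + 1) (n + 1))
       + (\<Sum>n\<le>p. mu ^ (p - n) * (mu + 1) ^ n * zeta2_bar (p - n + 1) (n + 1))"
proof (rule LIMSEQ_unique)
  show "(\<lambda>N. \<Sum>n\<le>p. mu ^ n * triangle_sum N (p - n + 1) (n + 1))
      \<longlonglongrightarrow> (\<Sum>n\<le>p. mu ^ n * (zeta_bar (p - n + 1) * zeta_bar (n + 1)))"
    by (intro tendsto_sum tendsto_mult[OF tendsto_const] triangle_sum_tendsto) auto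
  show "(\<lambda>N. \<Sum>n\<le>p. mu ^ n * triangle_sum N (p - n + 1) (n + 1))
      \<longlonglongrightarrow> (\<Sum>n\<le>p. (mu + 1) ^ n * zeta2_bar (p - n + 1) (n + 1))
       + (\<Sum>n\<le>p. mu ^ (p - n) * (mu + 1) ^ n * zeta2_bar (p - n + 1) (n + 1))"
    unfolding shuffle_partial_sums
    by (intro tendsto_add tendsto_sum tendsto_mult[OF tendsto_const] zeta2_bar_sum_tendsto) auto
qed

lemma coeff_monic_linear_power:
  "coeff ([:c, 1:] ^ n) i = real (n choose i) * c ^ (n - i)"
proof (cases "i \<le> n")
  case True
  then show ?thesis by (simp add: coeff_linear_poly_power)
next
  case False
  then have "degree ([:c, 1:] ^ n) < i"
    by (simp add: degree_linear_power)
  with False show ?thesis by (simp add: coeff_eq_0)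
qed

lemma sum_over_antidiagonal:
  "(\<Sum>(m, n)\<in>{(m, n). m + n = p}. f m n) = (\<Sum>n\<le>(p::nat). f (p - n) n)"
  by (rule sum.reindex_bij_witness[of _ "\<lambda>n. (p - n, n)" snd]) auto

lemma sum_over_antidiagonal_pairs:
  "(\<Sum>(m, n, a, b)\<in>{(m, n, a, b). m + n = p \<and> a + b = q}. f m n a b)
     = (\<Sum>n\<le>(p::nat). \<Sum>a\<le>(q::nat). f (p - n) n a (q - a))"
  unfolding sum.cartesian_product
  by (rule sum.reindex_bij_witness[of _ "\<lambda>(n, a). (p - n, n, a, q - a)" "\<lambda>(m, n, a, b). (n, a)"])
     auto

theorem theorem8p1:
  fixes p q :: nat and lam :: real
  shows "(\<Sum>(m, n) \<in> {(m, n). m + n = p}.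
            real (n choose q) * lam ^ (n - q) * zeta_bar (m + 1) * zeta_bar (n + 1))
       = (\<Sum>(m, n) \<in> {(m, n). m + n = p}.
            real (n choose q) * (lam + 1) ^ (n - q) * zeta2_bar (m + 1) (n + 1))
       + (\<Sum>(m, n, a, b) \<in> {(m, n, a, b). m + n = p \<and> a + b = q}.
            real (m choose a) * real (n choose b) * lam ^ (m - a) * (lam + 1) ^ (n - b)
              * zeta2_bar (m + 1) (n + 1))"
proof -
  \<comment> \<open>The variable of these polynomials is the shift \<open>y\<close> in \<open>\<mu> = \<lambda> + y\<close>.\<close>
  let ?X = "[:lam, 1:]" and ?Y = "[:lam + 1, 1:]"
  define L where
    "L = (\<Sum>n\<le>p. smult (zeta_bar (p - n + 1) * zeta_bar (n + 1)) (?X ^ n))"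
  define R where
    "R = (\<Sum>n\<le>p. smult (zeta2_bar (p - n + 1) (n + 1)) (?Y ^ n))
       + (\<Sum>n\<le>p. smult (zeta2_bar (p - n + 1) (n + 1)) (?X ^ (p - n) * ?Y ^ n))"
  have "poly L y = poly R y" for y
    using shuffle_zeta_bar[where mu = "lam + y" and p = p]
    by (simp add: L_def R_def poly_sum mult_ac add_ac)
  then have "L = R"
    by (intro iffD1[OF poly_eq_poly_eq_iff] ext)
  then have "coeff L q = coeff R q"
    by simp
  then show ?thesis
    unfolding sum_over_antidiagonal sum_over_antidiagonal_pairs
    by (simp add: L_def R_def coeff_sum coeff_mult coeff_monic_linear_power sum_distrib_left mult_ac
        del: mult_pCons_left mult_pCons_right)
qed

end
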